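(* Let $k$ be a positive integer, let $G$ be a $k$-colorable graph and let $A$ be a complete graph with $|A|$ vertices, vertex-disjoint from $G$. If $\mathcal{H}=(L,H)$ is a cover of the join $G\vee A$ such that $|L(a)|\ge |A|+\chi(G)$ for all $a\in V(A)$ and $$|A|\ \ge\ \frac{2k+2}{2k+1}\sum_{v\in V(G)}\max\{d_G(v)-|L(v)|+|A|+k,\,0\},$$ then $G\vee A$ is $\mathcal{H}$-colorable.
   Context: All graphs are finite and simple. $V(G)$, $E(G)$ denote the vertex and edge sets of $G$; $d_G(v)$ is the degree of $v$ in $G$; $\chi(G)$ is the chromatic number; $G$ is $k$-colorable if it has a proper coloring with colors in $\{1,\dots,k\}$ (equivalently $k\ge\chi(G)$). For vertex-disjoint graphs $G_1,G_2$, the join $G_1\vee G_2$ has vertex set $V(G_1)\cup V(G_2)$ and edge set $E(G_1)\cup E(G_2)\cup\{v_1v_2: v_1\in V(G_1),v_2\in V(G_2)\}$. A cover of a graph $G$ is an ordered pair $\mathcal{H}=(L,H)$, where $H$ is a graph and $L$ is a mapping from $V(G)$ to the power set of $V(H)$ such that: (1) the sets $L(u)$, $u\in V(G)$, partition $V(H)$; (2) for every $u\in V(G)$, the induced subgraph $H[L(u)]$ is complete; (3) if $u\ne v$ are not adjacent in $G$, then there are no edges of $H$ between $L(u)$ and $L(v)$; (4) for each edge $uv\in E(G)$, the set of edges of $H$ between $L(u)$ and $L(v)$ is a (not necessarily perfect, possibly empty) matching. An $\mathcal{H}$-coloring of $G$ is an independent set in $H$ of size $|V(G)|$ (it then contains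 exactly one vertex of each $L(v)$); $G$ is $\mathcal{H}$-colorable if it has an $\mathcal{H}$-coloring. *)

theory Defs
  imports Complex_Main "HOL-Library.Disjoint_Sets"
begin

record 'a sgraph =
  verts :: "'a set"
  edges :: "'a set set"

definition simple_graph :: "'a sgraph \<Rightarrow> bool" where
  "simple_graph G \<longleftrightarrow> finite (verts G) \<and> (\<forall>e\<in>edges G. e \<subseteq> verts G \<and> card e = 2)"

definition adjacent :: "'a sgraph \<Rightarrow> 'a \<Rightarrow> 'a \<Rightarrow> bool" where
  "adjacent G u v \<longleftrightarrow> {u, v} \<in> edges G"

definition degree :: "'a sgraph \<Rightarrow> 'a \<Rightarrow> nat" where
  "degree G v = card {e \<in> edges G. v \<in> e}"

definition complete_graph :: "'a sgraph \<Rightarrow> bool" where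
  "complete_graph G \<longleftrightarrow> simple_graph G \<and>
     (\<forall>u\<in>verts G. \<forall>v\<in>verts G. u \<noteq> v \<longrightarrow> adjacent G u v)"

definition induced_subgraph :: "'a sgraph \<Rightarrow> 'a set \<Rightarrow> 'a sgraph" where
  "induced_subgraph G S = \<lparr>verts = S, edges = {e \<in> edges G. e \<subseteq> S}\<rparr>"

definition independent_set :: "'a sgraph \<Rightarrow> 'a set \<Rightarrow> bool" where
  "independent_set G S \<longleftrightarrow> S \<subseteq> verts G \<and> (\<forall>u\<in>S. \<forall>v\<in>S. \<not> adjacent G u v)"

definition edges_between :: "'a sgraph \<Rightarrow> 'a set \<Rightarrow> 'a set \<Rightarrow> 'a set set" where
  "edges_between G S T = {e \<in> edges G. \<exists>x\<in>S. \<exists>y\<in>T. e = {x, y}}"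

definition matching :: "'a set set \<Rightarrow> bool" where
  "matching M \<longleftrightarrow> (\<forall>e\<in>M. \<forall>f\<in>M. e \<noteq> f \<longrightarrow> e \<inter> f = {})"

definition colorable :: "nat \<Rightarrow> 'a sgraph \<Rightarrow> bool" where
  "colorable k G \<longleftrightarrow> (\<exists>c :: 'a \<Rightarrow> nat. c ` verts G \<subseteq> {1..k} \<and>
     (\<forall>u\<in>verts G. \<forall>v\<in>verts G. adjacent G u v \<longrightarrow> c u \<noteq> c v))"

definition chromatic_number :: "'a sgraph \<Rightarrow> nat" where
  "chromatic_number G = (LEAST k. colorable k G)"

(* Only meaningful when the two vertex sets are disjoint. *)
definition join :: "'a sgraph \<Rightarrow> 'a sgraph \<Rightarrow> 'a sgraph" where
  "join G1 G2 = \<lparr>verts = verts G1 \<union> verts G2,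
     edges = edges G1 \<union> edges G2 \<union> {{v1, v2} | v1 v2. v1 \<in> verts G1 \<and> v2 \<in> verts G2}\<rparr>"

(* The first two conjuncts after simple_graph H say that the sets L u partition the vertices
   of H; an individual L u may be empty. Values of L outside verts G are irrelevant. *)
definition cover :: "'a sgraph \<Rightarrow> ('a \<Rightarrow> 'b set) \<times> 'b sgraph \<Rightarrow> bool" where
  "cover G = (\<lambda>(L, H). simple_graph H \<and>
     (\<Union>u\<in>verts G. L u) = verts H \<and> disjoint_family_on L (verts G) \<and>
     (\<forall>u\<in>verts G. complete_graph (induced_subgraph H (L u))) \<and>
     (\<forall>u\<in>verts G. \<forall>v\<in>verts G. u \<noteq> v \<and> \<not> adjacent G u v \<longrightarrow>
        edges_between H (L u) (L v) = {}) \<and>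
     (\<forall>u\<in>verts G. \<forall>v\<in>verts G. adjacent G u v \<longrightarrow>
        matching (edges_between H (L u) (L v))))"

definition cover_coloring ::
  "'a sgraph \<Rightarrow> ('a \<Rightarrow> 'b set) \<times> 'b sgraph \<Rightarrow> 'b set \<Rightarrow> bool" where
  "cover_coloring G = (\<lambda>(L, H) I. independent_set H I \<and> card I = card (verts G))"

definition cover_colorable :: "'a sgraph \<Rightarrow> ('a \<Rightarrow> 'b set) \<times> 'b sgraph \<Rightarrow> bool" where
  "cover_colorable G \<H> \<longleftrightarrow> (\<exists>I. cover_coloring G \<H> I)"

end

theory Submission imports Defs begin


text \<open>
The proof is by induction on the total number of vertices left to colour, with lists that shrink as
colours are chosen. Write \<open>n\<close> for the size of the clique \<open>A\<close>, let the excess of \<open>v\<close> in \<open>G\<close> be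
\<open>max (d(v) - |L(v)| + n + k) 0\<close>, and let \<open>\<sigma>\<close> be the sum of the excesses. The hypotheses to be kept
alive are \<open>(2k + 1) n \<ge> (2k + 2) \<sigma>\<close> and \<open>|L(a)| \<ge> n + q\<close> for \<open>a\<close> in \<open>A\<close>, where \<open>q\<close> is the number of
colour classes of a fixed proper colouring of \<open>G\<close>. A vertex \<open>v\<close> with \<open>|L(v)| > d(v) + n\<close> can be deleted
and coloured last, so every excess may be taken to be at least \<open>k\<close>.

Colouring a set \<open>B\<close> of \<open>m\<close> clique vertices removes \<open>m\<close> from \<open>n\<close>, and blocks at most \<open>m\<close> elements
of each \<open>L(v)\<close>. If it blocks fewer, because several of the chosen elements have the same neighbour in
\<open>L(v)\<close>, then the excess of \<open>v\<close> drops by the difference (as long as it stays nonnegative). Let \<open>R\<close> be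
the total drop. If \<open>(2k + 2) R \<ge> (2k + 1) m\<close>, the induction hypothesis applies to the rest
(\<open>feasible_precolour_clique\<close>). Otherwise \<open>R < m\<close> for every such partial colouring; for \<open>m = 1\<close> this
says that each element of each \<open>L(a)\<close> has a neighbour in every \<open>L(v)\<close>, whence
\<open>|L(v)| \<ge> |L(a)| \<ge> n + q\<close> and so \<open>d(v) \<ge> q\<close>.

Take a partial colouring of \<open>A\<close> with \<open>R \<ge> m - 1\<close> and \<open>m\<close> maximal. Then \<open>R = m - 1 \<le> 2k\<close>, and no
element that could extend it shares a neighbour with it in any list \<open>L(v)\<close> whose excess has not
yet dropped to zero. Double counting of shared neighbours gives \<open>b\<close> in \<open>B\<close> such that discarding \<open>b\<close>
lowers the total drop by at most one, hence affects at most one vertex \<open>v\<^sub>0\<close>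
(\<open>exists_removal_losing_at_most_one\<close>). If there is none, any colour class can be used up next.
Otherwise, as \<open>v\<^sub>0\<close> has at least \<open>q\<close> neighbours in the \<open>q - 1\<close> other
colour classes, one of these classes has two vertices, and therefore total excess at least \<open>2k\<close>
(\<open>exists_class_within_budget\<close>). Colour \<open>B - {b}\<close> as before, and colour each vertex of that class whose
excess has not dropped to zero with the neighbour of the element chosen at \<open>b\<close>. By maximality, every
element that becomes blocked in a list \<open>L(a)\<close> is a neighbour of one of the \<open>m\<close> elements chosen on \<open>B\<close>
(or is the one at \<open>b\<close>, if \<open>a = b\<close>), so \<open>L(a)\<close> loses at most \<open>m\<close> elements. This is just what
the bound \<open>n + q\<close> permits, since \<open>n\<close> falls by \<open>m - 1\<close> and \<open>q\<close> by one. The excess of the class pays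
for the decrease of \<open>n\<close>, and the induction hypothesis applies (\<open>feasible_precolour_class\<close>).
\<close>

section \<open>Redundancy of a map on a finite set\<close>

text \<open>Adding an element whose value is already taken raises the right-hand side by two; besides that
element, at most one other element, the previous sole owner of the value, starts to share its value.\<close>

lemma card_shared_le:
  assumes "finite B"
  shows "card {b \<in> B. \<exists>b'\<in>B. b' \<noteq> b \<and> f b' = f b} \<le> 2 * (card B - card (f ` B))"
  using assms
proof (induction B rule: finite_induct)
  case empty
  then show ?case by simp
next
  case (insert x B)
  let ?S = "\<lambda>B. {b \<in> B. \<exists>b'\<in>B. b' \<noteq> b \<and> f b' = f b}"
  have le: "card (f ` B) \<le> card B" using insert card_image_le by blast
  show ?case
  proof (cases "f x \<in> f ` B")
    case False
    have "?S (insert x B) = ?S B" using False insert(2) by (auto simp: image_iff)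
    moreover have "card (f ` insert x B) = Suc (card (f ` B))" using False insert by simp
    ultimately show ?thesis using insert by simp
  next
    case True
    then obtain x' where x': "x' \<in> B" "f x' = f x" by auto
    have "?S (insert x B) \<subseteq> insert x (insert x' (?S B))"
      using x' by (smt (verit, best) insert_iff mem_Collect_eq subsetI)
    then have "card (?S (insert x B)) \<le> card (insert x (insert x' (?S B)))"
      using insert by (intro card_mono) auto
    also have "\<dots> \<le> card (?S B) + 2"
      using insert(1) by (simp add: card_insert_if)
    also have "\<dots> \<le> 2 * (card B - card (f ` B)) + 2" using insert by simp
    also have "\<dots> = 2 * (card (insert x B) - card (f ` insert x B))"
      using True insert le by (simp add: insert_absorb)
    finally show ?thesis .
  qed
qed

text \<open>The chosen elements will be mapped to their neighbours in one list; the redundancy is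
then the number of elements of the list that coincidences of neighbours keep free.\<close>

definition redundancy :: "('c \<Rightarrow> 'd) \<Rightarrow> 'c set \<Rightarrow> nat" where
  "redundancy h C = card C - card (h ` C)"

lemma redundancy_remove_shared:
  assumes "finite B" "b \<in> B" "b' \<in> B" "b' \<noteq> b" "h b' = h b"
  shows "redundancy h B = Suc (redundancy h (B - {b}))"
proof -
  have "h ` B = h ` (B - {b})" using assms by (auto simp: image_iff) (metis Diff_iff singletonD)
  moreover have "card (h ` (B - {b})) \<le> card (B - {b})" using assms by (intro card_image_le) auto
  moreover have "card B = Suc (card (B - {b}))" using assms by (metis card.remove)
  ultimately show ?thesis unfolding redundancy_def by simp
qed

lemma redundancy_remove_private:
  assumes "finite B" "b \<in> B" "\<And>b'. b' \<in> B \<Longrightarrow> b' \<noteq> b \<Longrightarrow> h b' \<noteq> h b"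
  shows "redundancy h B = redundancy h (B - {b})"
proof -
  have "h ` B = insert (h b) (h ` (B - {b}))" using insert_Diff[OF assms(2)] by (metis image_insert)
  moreover have "h b \<notin> h ` (B - {b})" using assms(3) by fastforce
  moreover have "card B = Suc (card (B - {b}))" using assms by (metis card.remove)
  ultimately show ?thesis using assms unfolding redundancy_def by simp
qed

text \<open>The cap \<open>e\<close> will be the excess of a vertex, since a drop beyond the excess is worth nothing. If
the redundancy is above the cap, a single removal costs nothing; otherwise only the elements that
share their value cost anything, namely one each.\<close>

lemma sum_capped_loss_le:
  fixes e :: nat
  assumes "finite B"
  shows "(\<Sum>b\<in>B. min (redundancy h B) e - min (redundancy h (B - {b})) e) \<le> 2 * min (redundancy h B) e"
proof -
  let ?sh = "\<lambda>b. \<exists>b'\<in>B. b' \<noteq> b \<and> h b' = h b"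
  have *: "redundancy h B \<le> redundancy h (B - {b}) + of_bool (?sh b)" if "b \<in> B" for b
  proof (cases "?sh b")
    case True
    then show ?thesis using redundancy_remove_shared[OF assms that, of _ h] by force
  next
    case False
    then have "redundancy h B = redundancy h (B - {b})"
      using redundancy_remove_private[OF assms that, of h] by blast
    then show ?thesis by simp
  qed
  show ?thesis
  proof (cases "e < redundancy h B")
    case True
    have "min (redundancy h B) e - min (redundancy h (B - {b})) e = 0" if "b \<in> B" for b
      using *[OF that] True by (cases "?sh b") auto
    then show ?thesis by simp
  next
    case False
    have "(\<Sum>b\<in>B. min (redundancy h B) e - min (redundancy h (B - {b})) e) \<le> (\<Sum>b\<in>B. of_bool (?sh b))"
    proof (rule sum_mono)
      fix b assume "b \<in> B"
      show "min (redundancy h B) e - min (redundancy h (B - {b})) e \<le> of_bool (?sh b)"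
        using *[OF \<open>b \<in> B\<close>] False by (cases "?sh b") auto
    qed
    also have "\<dots> = card {b \<in> B. ?sh b}"
      using assms by (simp add: Int_def)
    also have "\<dots> \<le> 2 * min (redundancy h B) e"
      using card_shared_le[OF assms, of h] False unfolding redundancy_def by simp
    finally show ?thesis .
  qed
qed

lemma private_if_capped_lossless:
  assumes "finite B" "b \<in> B" "redundancy h B < e"
    and "min (redundancy h B) e \<le> min (redundancy h (B - {b})) e"
    and "b' \<in> B" "b' \<noteq> b"
  shows "h b' \<noteq> h b"
  using redundancy_remove_shared[of B b b' h] assms by auto

section \<open>Colourings from shrinking lists\<close>

text \<open>The graph \<open>G\<close> and the cover graph enter only through their adjacency relations \<open>E\<close> and \<open>N\<close>,
which stay fixed while vertex sets and lists shrink; induction then needs no subgraphs.\<close>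

locale conflict_system =
  fixes E :: "'a \<Rightarrow> 'a \<Rightarrow> bool" and N :: "'b \<Rightarrow> 'b \<Rightarrow> bool"
  assumes N_sym: "N x y \<Longrightarrow> N y x"
begin

definition colours :: "'a set \<Rightarrow> ('a \<Rightarrow> 'b set) \<Rightarrow> ('a \<Rightarrow> 'b) \<Rightarrow> bool" where
  "colours W L f \<longleftrightarrow> (\<forall>v\<in>W. f v \<in> L v) \<and> (\<forall>u\<in>W. \<forall>v\<in>W. u \<noteq> v \<longrightarrow> \<not> N (f u) (f v))"

text \<open>The part of a cover of the join of \<open>G\<close> and \<open>A\<close> that is inherited by smaller vertex sets and shorter lists.\<close>

definition covers :: "'a set \<Rightarrow> 'a set \<Rightarrow> ('a \<Rightarrow> 'b set) \<Rightarrow> bool" where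
  "covers V A L \<longleftrightarrow> finite V \<and> finite A \<and> V \<inter> A = {} \<and> (\<forall>u\<in>V\<union>A. finite (L u)) \<and>
     (\<forall>u\<in>V\<union>A. \<forall>v\<in>V\<union>A. u \<noteq> v \<longrightarrow>
        (\<forall>y\<in>L u. \<forall>z\<in>L v. \<forall>z'\<in>L v. N y z \<longrightarrow> N y z' \<longrightarrow> z = z')) \<and>
     (\<forall>u\<in>V. \<forall>v\<in>V. u \<noteq> v \<longrightarrow> \<not> E u v \<longrightarrow> (\<forall>y\<in>L u. \<forall>z\<in>L v. \<not> N y z))"

definition blocked :: "('a \<Rightarrow> 'b set) \<Rightarrow> 'a set \<Rightarrow> ('a \<Rightarrow> 'b) \<Rightarrow> 'a \<Rightarrow> 'b set" where
  "blocked L C g v = {z \<in> L v. \<exists>c\<in>C. N (g c) z}"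

definition residual :: "('a \<Rightarrow> 'b set) \<Rightarrow> 'a set \<Rightarrow> ('a \<Rightarrow> 'b) \<Rightarrow> 'a \<Rightarrow> 'b set" where
  "residual L C g v = L v - blocked L C g v"

definition deg :: "'a set \<Rightarrow> 'a \<Rightarrow> nat" where
  "deg V v = card {w \<in> V. E v w}"

text \<open>Truncated subtraction supplies the maximum with zero.\<close>

definition excess :: "nat \<Rightarrow> 'a set \<Rightarrow> 'a set \<Rightarrow> ('a \<Rightarrow> 'b set) \<Rightarrow> 'a \<Rightarrow> nat" where
  "excess k V A L v = deg V v + card A + k - card (L v)"

lemma covers_mono:
  assumes "covers V A L" "V' \<subseteq> V" "A' \<subseteq> A" "\<And>v. L' v \<subseteq> L v"
  shows "covers V' A' L'"
proof -
  have sub: "V' \<union> A' \<subseteq> V \<union> A" using assms by blast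
  have f: "\<forall>u\<in>V'\<union>A'. finite (L' u)"
    using assms(1,4) sub unfolding covers_def by (meson finite_subset subsetD)
  have "finite V'" "finite A'" "V' \<inter> A' = {}"
    using assms unfolding covers_def by (auto intro: finite_subset)
  moreover have "\<forall>u\<in>V'\<union>A'. \<forall>v\<in>V'\<union>A'. u \<noteq> v \<longrightarrow>
        (\<forall>y\<in>L' u. \<forall>z\<in>L' v. \<forall>z'\<in>L' v. N y z \<longrightarrow> N y z' \<longrightarrow> z = z')"
    using assms(1,4) sub unfolding covers_def by (meson subsetD)
  moreover have "\<forall>u\<in>V'. \<forall>v\<in>V'. u \<noteq> v \<longrightarrow> \<not> E u v \<longrightarrow> (\<forall>y\<in>L' u. \<forall>z\<in>L' v. \<not> N y z)"
    using assms(1,2,4) unfolding covers_def by (meson subsetD)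
  ultimately show ?thesis using f unfolding covers_def by blast
qed

lemma covers_finite:
  assumes "covers V A L"
  shows "finite V" "finite A" "V \<inter> A = {}" "u \<in> V \<union> A \<Longrightarrow> finite (L u)"
proof -
  have "\<forall>u\<in>V\<union>A. finite (L u)" using assms unfolding covers_def by (elim conjE)
  then show "u \<in> V \<union> A \<Longrightarrow> finite (L u)" by blast
  show "finite V" "finite A" "V \<inter> A = {}"
    using assms unfolding covers_def by - (elim conjE, assumption)+
qed

lemma covers_unique:
  assumes "covers V A L" "u \<in> V \<union> A" "v \<in> V \<union> A" "u \<noteq> v" "y \<in> L u" "z \<in> L v" "z' \<in> L v" "N y z" "N y z'"
  shows "z = z'"
proof -
  have "\<forall>u\<in>V\<union>A. \<forall>v\<in>V\<union>A. u \<noteq> v \<longrightarrow>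
        (\<forall>y\<in>L u. \<forall>z\<in>L v. \<forall>z'\<in>L v. N y z \<longrightarrow> N y z' \<longrightarrow> z = z')"
    using assms(1) unfolding covers_def by (elim conjE)
  from this[rule_format, OF assms(2-9)] show ?thesis .
qed

lemma covers_adjacent:
  assumes "covers V A L" "u \<in> V" "v \<in> V" "u \<noteq> v" "y \<in> L u" "z \<in> L v" "N y z"
  shows "E u v"
proof -
  have "\<forall>u\<in>V. \<forall>v\<in>V. u \<noteq> v \<longrightarrow> \<not> E u v \<longrightarrow> (\<forall>y\<in>L u. \<forall>z\<in>L v. \<not> N y z)"
    using assms(1) unfolding covers_def by (elim conjE)
  then show ?thesis using assms(2-) by metis
qed

lemma card_residual:
  assumes "finite (L v)"
  shows "card (residual L C g v) = card (L v) - card (blocked L C g v)"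
    and "card (blocked L C g v) \<le> card (L v)"
proof -
  have s: "blocked L C g v \<subseteq> L v" unfolding blocked_def by auto
  show "card (residual L C g v) = card (L v) - card (blocked L C g v)"
    unfolding residual_def using s assms by (meson card_Diff_subset finite_subset)
  show "card (blocked L C g v) \<le> card (L v)" using s assms by (simp add: card_mono)
qed

lemma card_blocked_le:
  assumes "finite T"
    and "\<And>c z. c \<in> C \<Longrightarrow> z \<in> L v \<Longrightarrow> N (g c) z \<Longrightarrow> c \<in> T"
    and "\<And>c z z'. c \<in> T \<Longrightarrow> z \<in> L v \<Longrightarrow> z' \<in> L v \<Longrightarrow> N (g c) z \<Longrightarrow> N (g c) z' \<Longrightarrow> z = z'"
  shows "card (blocked L C g v) \<le> card T"
proof -
  have "blocked L C g v \<subseteq> (\<lambda>c. THE z. z \<in> L v \<and> N (g c) z) ` T"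
  proof
    fix z assume "z \<in> blocked L C g v"
    then obtain c where c: "c \<in> C" "z \<in> L v" "N (g c) z" unfolding blocked_def by auto
    then have "c \<in> T" using assms(2) by blast
    moreover have "(THE z. z \<in> L v \<and> N (g c) z) = z"
      using c assms(3)[OF \<open>c \<in> T\<close>] by blast
    ultimately show "z \<in> (\<lambda>c. THE z. z \<in> L v \<and> N (g c) z) ` T"
      by (intro image_eqI[of _ _ c]) simp_all
  qed
  then show ?thesis using assms(1) by (meson card_image_le card_mono finite_imageI le_trans)
qed

lemma colours_insert:
  assumes "colours W L f" "v \<notin> W" "finite (L v)" "card (blocked L W f v) < card (L v)"
  shows "\<exists>f. colours (insert v W) L f"
proof -
  have "\<not> L v \<subseteq> blocked L W f v"
    using assms(4) card_mono[of "blocked L W f v" "L v"] assms(3) finite_subset[of "blocked L W f v" "L v"]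
    unfolding blocked_def by fastforce
  then obtain z where z: "z \<in> L v" "\<forall>c\<in>W. \<not> N (f c) z" unfolding blocked_def by auto
  have "colours (insert v W) L (f(v := z))"
    unfolding colours_def
  proof (intro conjI ballI impI)
    fix u assume "u \<in> insert v W"
    then show "(f(v := z)) u \<in> L u" using z assms(1) unfolding colours_def by auto
  next
    fix u w assume "u \<in> insert v W" "w \<in> insert v W" "u \<noteq> w"
    moreover have "\<not> N z (f c)" if "c \<in> W" for c
      using z that N_sym by blast
    moreover have "\<not> N (f u) (f w)" if "u \<in> W" "w \<in> W"
      using assms(1) that \<open>u \<noteq> w\<close> unfolding colours_def by blast
    ultimately show "\<not> N ((f(v := z)) u) ((f(v := z)) w)"
      using z by auto
  qed
  then show ?thesis by blast
qed

lemma colours_residual: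
  assumes "colours C L g" "colours W (residual L C g) f" "W \<inter> C = {}"
  shows "\<exists>f. colours (W \<union> C) L f"
proof -
  have "colours (W \<union> C) L (\<lambda>v. if v \<in> C then g v else f v)"
    unfolding colours_def
  proof (intro conjI ballI impI)
    fix u assume "u \<in> W \<union> C"
    then show "(if u \<in> C then g u else f u) \<in> L u"
      using assms unfolding colours_def residual_def by auto
  next
    have x: "\<not> N (g c) (f w)" if "c \<in> C" "w \<in> W" for c w
      using assms(2) that unfolding colours_def residual_def blocked_def by auto
    fix u w assume "u \<in> W \<union> C" "w \<in> W \<union> C" "u \<noteq> w"
    moreover have x': "\<not> N (f w) (g c)" if "c \<in> C" "w \<in> W" for c w
      using x[OF that] N_sym by blast
    moreover have "\<not> N (g u) (g w)" if "u \<in> C" "w \<in> C"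
      using assms(1) that \<open>u \<noteq> w\<close> unfolding colours_def by blast
    moreover have "\<not> N (f u) (f w)" if "u \<in> W" "w \<in> W"
      using assms(2) that \<open>u \<noteq> w\<close> unfolding colours_def by blast
    ultimately show "\<not> N (if u \<in> C then g u else f u) (if w \<in> C then g w else f w)"
      using x by auto
  qed
  then show ?thesis by blast
qed

lemma colours_clique:
  assumes "covers V A L" "\<And>a. a \<in> A \<Longrightarrow> card A \<le> card (L a)"
  shows "\<exists>f. colours A L f"
proof -
  note fA = covers_finite(2)[OF assms(1)]
  have "\<exists>f. colours B L f" if "B \<subseteq> A" for B
    using finite_subset[OF that fA] that
  proof (induction B rule: finite_induct)
    case empty
    show ?case unfolding colours_def by auto
  next
    case (insert v B)
    then obtain f where f: "colours B L f" by auto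
    have "card (blocked L B f v) \<le> card B"
    proof (rule card_blocked_le)
      fix c z z' assume "c \<in> B" "z \<in> L v" "z' \<in> L v" "N (f c) z" "N (f c) z'"
      moreover have "f c \<in> L c" using f \<open>c \<in> B\<close> unfolding colours_def by auto
      moreover have "c \<in> V \<union> A" "v \<in> V \<union> A" "c \<noteq> v" using insert \<open>c \<in> B\<close> by auto
      ultimately show "z = z'" using covers_unique[OF assms(1)] by blast
    qed (use insert in auto)
    moreover have "card B < card A"
      using insert fA by (intro psubset_card_mono) auto
    moreover have "card A \<le> card (L v)" "finite (L v)"
      using insert assms(2) covers_finite(4)[OF assms(1)] by auto
    ultimately show ?case using colours_insert[OF f insert(2)] by simp
  qed
  then show ?thesis by blast
qed

section \<open>The conditions preserved by the induction\<close>

text \<open>The drop in the excess of \<open>v\<close> caused by colouring the clique vertices in \<open>B\<close> with \<open>g\<close>.\<close>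

definition saved :: "nat \<Rightarrow> 'a set \<Rightarrow> 'a set \<Rightarrow> ('a \<Rightarrow> 'b set) \<Rightarrow> 'a set \<Rightarrow> ('a \<Rightarrow> 'b) \<Rightarrow> 'a \<Rightarrow> nat" where
  "saved k V A L B g v = min (card B - card (blocked L B g v)) (excess k V A L v)"

text \<open>Only the classes of vertices with positive excess are counted. A vertex whose excess has vanished
can be coloured greedily at the very end, so it may stay in a class that has otherwise been used up.\<close>

definition feasible :: "nat \<Rightarrow> ('a \<Rightarrow> nat) \<Rightarrow> 'a set \<Rightarrow> 'a set \<Rightarrow> ('a \<Rightarrow> 'b set) \<Rightarrow> bool" where
  "feasible k c V A L \<longleftrightarrow> covers V A L \<and>
     (\<forall>a\<in>A. card A + card (c ` {v\<in>V. 0 < excess k V A L v}) \<le> card (L a)) \<and>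
     (2 * k + 2) * (\<Sum>v\<in>V. excess k V A L v) \<le> (2 * k + 1) * card A"

lemma blocked_cong: "(\<And>b. b \<in> C \<Longrightarrow> g b = g' b) \<Longrightarrow> blocked L C g v = blocked L C g' v"
  unfolding blocked_def by auto

lemma saved_cong: "(\<And>b. b \<in> C \<Longrightarrow> g b = g' b) \<Longrightarrow> saved k V A L C g v = saved k V A L C g' v"
  unfolding saved_def using blocked_cong[of C g g' L v] by simp

lemma card_blocked_colours:
  assumes "covers V A L" "C \<subseteq> V \<union> A" "colours C L g" "v \<in> V \<union> A" "v \<notin> C"
  shows "card (blocked L C g v) \<le> card C"
proof (rule card_blocked_le)
  show "finite C" using finite_subset[OF assms(2)] covers_finite(1,2)[OF assms(1)] by simp
  fix c z z' assume *: "c \<in> C" "z \<in> L v" "z' \<in> L v" "N (g c) z" "N (g c) z'"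
  then have "g c \<in> L c" "c \<in> V \<union> A" "c \<noteq> v" using assms(2,3,5) unfolding colours_def by blast+
  from covers_unique[OF assms(1) this(2) assms(4) this(3) this(1) *(2-5)] show "z = z'" .
qed auto

lemma feasible_delete:
  assumes "feasible k c V A L" "w \<in> V"
  shows "feasible k c (V - {w}) A L"
proof -
  have v: "covers V A L" using assms unfolding feasible_def by auto
  note fV = covers_finite(1)[OF v]
  have e: "excess k (V - {w}) A L v \<le> excess k V A L v" for v
  proof -
    have "deg (V - {w}) v \<le> deg V v" unfolding deg_def using fV by (intro card_mono) auto
    then show ?thesis unfolding excess_def by simp
  qed
  have sub: "{v\<in>V - {w}. 0 < excess k (V - {w}) A L v} \<subseteq> {v\<in>V. 0 < excess k V A L v}"
    using e by (auto intro: less_le_trans)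
  have "card (c ` {v\<in>V - {w}. 0 < excess k (V - {w}) A L v}) \<le> card (c ` {v\<in>V. 0 < excess k V A L v})"
    using fV by (intro card_mono finite_imageI image_mono sub) auto
  then have 1: "\<forall>a\<in>A. card A + card (c ` {v\<in>V - {w}. 0 < excess k (V - {w}) A L v}) \<le> card (L a)"
    using assms(1) unfolding feasible_def by fastforce
  have "(\<Sum>v\<in>V - {w}. excess k (V - {w}) A L v) \<le> (\<Sum>v\<in>V - {w}. excess k V A L v)"
    by (intro sum_mono e)
  also have "\<dots> \<le> (\<Sum>v\<in>V. excess k V A L v)" using fV by (intro sum_mono2) auto
  finally have "(2 * k + 2) * (\<Sum>v\<in>V - {w}. excess k (V - {w}) A L v) \<le> (2 * k + 1) * card A"
    using assms(1) order_trans[OF mult_le_mono2] unfolding feasible_def by blast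
  then show ?thesis using 1 covers_mono[OF v, of "V - {w}" A L] unfolding feasible_def by auto
qed

text \<open>A coloured neighbour in \<open>U\<close> costs a list element but also lowers the degree by one, so colouring
\<open>U\<close> never raises an excess. The same trade between \<open>B\<close> and the size of the clique leaves the drop.\<close>

lemma excess_precolour:
  assumes v: "covers V A L" and B: "B \<subseteq> A" and U: "U \<subseteq> V" and p: "colours (U \<union> B) L p"
    and w: "w \<in> V - U"
  shows "excess k (V - U) (A - B) (residual L (U \<union> B) p) w \<le> excess k V A L w - saved k V A L B p w"
proof -
  have fin: "finite V" "finite A" "finite (L w)" "finite U" "finite B"
    using covers_finite[OF v] w finite_subset[OF U] finite_subset[OF B] by auto
  have wA: "w \<notin> B" using covers_finite(3)[OF v] w B by auto
  have hu: "blocked L (U \<union> B) p w = blocked L U p w \<union> blocked L B p w" unfolding blocked_def by auto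
  let ?T = "{u\<in>U. E w u}"
  have "card (blocked L U p w) \<le> card ?T"
  proof (rule card_blocked_le)
    show "finite ?T" using fin by simp
    fix c z assume *: "c \<in> U" "z \<in> L w" "N (p c) z"
    then have "p c \<in> L c" "c \<in> V" "c \<noteq> w" using p U w unfolding colours_def by auto
    then have "E w c" using covers_adjacent[OF v, of w c z "p c"] * w N_sym[OF *(3)] by auto
    then show "c \<in> ?T" using * by simp
  next
    fix c z z' assume *: "c \<in> ?T" "z \<in> L w" "z' \<in> L w" "N (p c) z" "N (p c) z'"
    then have "p c \<in> L c" "c \<in> V" "c \<noteq> w" using p U w unfolding colours_def by auto
    then show "z = z'" using covers_unique[OF v, of c w "p c" z z'] *(2-5) w by auto
  qed
  moreover have "card (blocked L B p w) \<le> card B"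
    using card_blocked_colours[OF v, of B p w] B p w wA unfolding colours_def by auto
  moreover have "card (blocked L (U \<union> B) p w) \<le> card (blocked L U p w) + card (blocked L B p w)"
    unfolding hu by (rule card_Un_le)
  moreover have "deg V w = deg (V - U) w + card ?T"
  proof -
    have "{u\<in>V. E w u} = {u\<in>V - U. E w u} \<union> ?T" using U by auto
    moreover have "{u\<in>V - U. E w u} \<inter> ?T = {}" by auto
    ultimately show ?thesis unfolding deg_def using fin by (simp add: card_Un_disjoint)
  qed
  moreover have "card (A - B) = card A - card B" "card B \<le> card A"
    using fin B by (auto simp: card_Diff_subset card_mono)
  ultimately show ?thesis
    using card_residual[where L = L and v = w and C = "U \<union> B" and g = p, OF fin(3)]
    unfolding excess_def saved_def by simp
qed

text \<open>If \<open>q\<close> colour classes are used up, the lists of the remaining clique vertices may lose \<open>q\<close> elements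
beyond the number of clique vertices coloured. Only the cases \<open>q = 0\<close> and \<open>q = 1\<close> will occur.\<close>

lemma feasible_precolour:
  assumes feas: "feasible k c V A L" and B: "B \<subseteq> A" and U: "U \<subseteq> V" and p: "colours (U \<union> B) L p"
    and act: "card (c ` {v\<in>V - U. saved k V A L B p v < excess k V A L v}) + q
                \<le> card (c ` {v\<in>V. 0 < excess k V A L v})"
    and loss: "\<And>a. a \<in> A - B \<Longrightarrow> card (blocked L (U \<union> B) p a) \<le> card B + q"
    and budget: "(2 * k + 2) * (\<Sum>v\<in>V - U. excess k V A L v - saved k V A L B p v)
                   \<le> (2 * k + 1) * (card A - card B)"
  shows "feasible k c (V - U) (A - B) (residual L (U \<union> B) p)"
proof -
  let ?L = "residual L (U \<union> B) p"
  have v: "covers V A L" using feas unfolding feasible_def by auto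
  have fin: "finite V" "finite A" "finite B"
    using covers_finite(1,2)[OF v] finite_subset[OF B] by auto
  have v': "covers (V - U) (A - B) ?L" by (rule covers_mono[OF v]) (auto simp: residual_def)
  have cd: "card (A - B) = card A - card B" "card B \<le> card A"
    using fin B by (auto simp: card_Diff_subset card_mono)
  note ex = excess_precolour[OF v B U p, of _ k]
  have "{v\<in>V - U. 0 < excess k (V - U) (A - B) ?L v} \<subseteq> {v\<in>V - U. saved k V A L B p v < excess k V A L v}"
  proof (intro Collect_mono impI)
    fix x assume "x \<in> V - U \<and> 0 < excess k (V - U) (A - B) ?L x"
    then show "x \<in> V - U \<and> saved k V A L B p x < excess k V A L x" using ex[of x] by linarith
  qed
  then have "card (c ` {v\<in>V - U. 0 < excess k (V - U) (A - B) ?L v})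
       \<le> card (c ` {v\<in>V - U. saved k V A L B p v < excess k V A L v})"
    using fin by (intro card_mono finite_imageI image_mono) auto
  then have 1: "card (A - B) + card (c ` {v\<in>V - U. 0 < excess k (V - U) (A - B) ?L v}) \<le> card (?L a)"
    if "a \<in> A - B" for a
  proof -
    have "finite (L a)" using covers_finite(4)[OF v] that by auto
    moreover have "card A + card (c ` {v\<in>V. 0 < excess k V A L v}) \<le> card (L a)"
      using feas that unfolding feasible_def by auto
    ultimately show ?thesis using card_residual[of L a "U \<union> B" p] loss[OF that] act cd
        \<open>card (c ` {v\<in>V - U. 0 < excess k (V - U) (A - B) ?L v}) \<le> _\<close> by linarith
  qed
  have le: "(\<Sum>v\<in>V - U. excess k (V - U) (A - B) ?L v) \<le> (\<Sum>v\<in>V - U. excess k V A L v - saved k V A L B p v)"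
    by (intro sum_mono ex)
  have "(2 * k + 2) * (\<Sum>v\<in>V - U. excess k (V - U) (A - B) ?L v) \<le> (2 * k + 1) * card (A - B)"
    unfolding cd(1) by (rule order_trans[OF mult_le_mono2[OF le] budget])
  then show ?thesis using v' 1 unfolding feasible_def by auto
qed

lemma feasible_precolour_clique:
  assumes feas: "feasible k c V A L" and B: "B \<subseteq> A" and g: "colours B L g"
    and big: "(2 * k + 1) * card B \<le> (2 * k + 2) * (\<Sum>v\<in>V. saved k V A L B g v)"
  shows "feasible k c V (A - B) (residual L B g)"
proof -
  have v: "covers V A L" using feas unfolding feasible_def by auto
  have fin: "finite V" "finite A" "finite B"
    using covers_finite(1,2)[OF v] finite_subset[OF B] by auto
  have "feasible k c (V - {}) (A - B) (residual L ({} \<union> B) g)"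
  proof (rule feasible_precolour[OF feas B, where q = 0])
    show "card (c ` {v\<in>V - {}. saved k V A L B g v < excess k V A L v}) + 0
                \<le> card (c ` {v\<in>V. 0 < excess k V A L v})"
      using fin by (simp, intro card_mono finite_imageI image_mono) auto
    show "card (blocked L ({} \<union> B) g a) \<le> card B + 0" if "a \<in> A - B" for a
      using card_blocked_colours[OF v, of B g a] B g that by auto
    have "(\<Sum>v\<in>V. excess k V A L v - saved k V A L B g v) + (\<Sum>v\<in>V. saved k V A L B g v)
            = (\<Sum>v\<in>V. excess k V A L v)"
      by (subst sum.distrib[symmetric], rule sum.cong) (auto simp: saved_def)
    then have "(2 * k + 2) * (\<Sum>v\<in>V. excess k V A L v - saved k V A L B g v)
        + (2 * k + 2) * (\<Sum>v\<in>V. saved k V A L B g v) = (2 * k + 2) * (\<Sum>v\<in>V. excess k V A L v)"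
      by (metis add_mult_distrib2)
    moreover have "(2 * k + 2) * (\<Sum>v\<in>V. excess k V A L v) \<le> (2 * k + 1) * card A"
      using feas unfolding feasible_def by auto
    moreover have "(2 * k + 1) * (card A - card B) = (2 * k + 1) * card A - (2 * k + 1) * card B"
      by (rule diff_mult_distrib2)
    ultimately show "(2 * k + 2) * (\<Sum>v\<in>V - {}. excess k V A L v - saved k V A L B g v)
                   \<le> (2 * k + 1) * (card A - card B)"
      using big by (simp del: mult_Suc mult_Suc_right)
  qed (use g in auto)
  then show ?thesis by simp
qed

section \<open>Coincidences of neighbours\<close>

definition nbr :: "('a \<Rightarrow> 'b set) \<Rightarrow> ('a \<Rightarrow> 'b) \<Rightarrow> 'a \<Rightarrow> 'a \<Rightarrow> 'b" where
  "nbr L g v b = (SOME z. z \<in> L v \<and> N (g b) z)"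

lemma nbr_spec:
  assumes "\<exists>z\<in>L v. N (g b) z"
  shows "nbr L g v b \<in> L v" "N (g b) (nbr L g v b)"
  using someI_ex[of "\<lambda>z. z \<in> L v \<and> N (g b) z"] assms unfolding nbr_def by auto

lemma nbr_eqI:
  assumes "covers V A L" "b \<in> A" "v \<in> V" "g b \<in> L b" "z \<in> L v" "N (g b) z"
  shows "nbr L g v b = z"
proof -
  have "b \<noteq> v" using assms(2,3) covers_finite(3)[OF assms(1)] by auto
  have ex: "\<exists>z\<in>L v. N (g b) z" using assms by auto
  show ?thesis
    using covers_unique[OF assms(1) _ _ \<open>b \<noteq> v\<close> assms(4) nbr_spec(1)[of L v g b, OF ex] assms(5)
        nbr_spec(2)[of L v g b, OF ex] assms(6)] assms(2,3) by blast
qed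

lemma blocked_eq_nbr:
  assumes "covers V A L" "C \<subseteq> A" "colours C L g" "v \<in> V" "\<And>b. b \<in> C \<Longrightarrow> \<exists>z\<in>L v. N (g b) z"
  shows "blocked L C g v = nbr L g v ` C"
proof
  show "blocked L C g v \<subseteq> nbr L g v ` C"
  proof
    fix z assume "z \<in> blocked L C g v"
    then obtain b where b: "b \<in> C" "z \<in> L v" "N (g b) z" unfolding blocked_def by auto
    then have "nbr L g v b = z"
      using nbr_eqI[where g = g and b = b and z = z, OF assms(1) _ assms(4) _ b(2,3)] assms(2,3) unfolding colours_def by auto
    then show "z \<in> nbr L g v ` C" using b by auto
  qed
  show "nbr L g v ` C \<subseteq> blocked L C g v"
    using nbr_spec[of L v g] assms(5) unfolding blocked_def by blast
qed

lemma saved_eq_redundancy: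
  assumes "covers V A L" "C \<subseteq> A" "colours C L g" "v \<in> V" "\<And>b. b \<in> C \<Longrightarrow> \<exists>z\<in>L v. N (g b) z"
  shows "saved k V A L C g v = min (redundancy (nbr L g v) C) (excess k V A L v)"
  using blocked_eq_nbr[OF assms] unfolding saved_def redundancy_def by simp

lemma colours_subset: "colours C L g \<Longrightarrow> D \<subseteq> C \<Longrightarrow> colours D L g"
  unfolding colours_def by blast

text \<open>By \<open>sum_capped_loss_le\<close>, the total drop lost over all \<open>b\<close> in \<open>B\<close> is at most twice the total drop, hence below
\<open>2 |B|\<close>; so the average loss is below two.\<close>

lemma exists_removal_losing_at_most_one:
  assumes v: "covers V A L" and B: "B \<subseteq> A" and g: "colours B L g"
    and ex: "\<And>b w. b \<in> B \<Longrightarrow> w \<in> V \<Longrightarrow> \<exists>z\<in>L w. N (g b) z"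
    and R: "(\<Sum>w\<in>V. saved k V A L B g w) < card B"
  shows "\<exists>b\<in>B. (\<Sum>w\<in>V. saved k V A L B g w - saved k V A L (B - {b}) g w) \<le> 1"
proof (rule ccontr)
  assume "\<not> ?thesis"
  then have *: "2 \<le> (\<Sum>w\<in>V. saved k V A L B g w - saved k V A L (B - {b}) g w)" if "b \<in> B" for b
    using that by force
  have fB: "finite B" using finite_subset[OF B covers_finite(2)[OF v]] .
  have eq: "saved k V A L C g w = min (redundancy (nbr L g w) C) (excess k V A L w)"
    if "C \<subseteq> B" "w \<in> V" for C w
    using saved_eq_redundancy[OF v _ colours_subset[OF g that(1)] that(2)] B ex that by blast
  have "2 * card B = (\<Sum>b\<in>B. 2)" by simp
  also have "\<dots> \<le> (\<Sum>b\<in>B. \<Sum>w\<in>V. saved k V A L B g w - saved k V A L (B - {b}) g w)"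
    by (intro sum_mono *)
  also have "\<dots> = (\<Sum>w\<in>V. \<Sum>b\<in>B. saved k V A L B g w - saved k V A L (B - {b}) g w)"
    by (rule sum.swap)
  also have "\<dots> \<le> (\<Sum>w\<in>V. 2 * saved k V A L B g w)"
  proof (rule sum_mono)
    fix w assume "w \<in> V"
    then show "(\<Sum>b\<in>B. saved k V A L B g w - saved k V A L (B - {b}) g w) \<le> 2 * saved k V A L B g w"
      using sum_capped_loss_le[OF fB, of "nbr L g w" "excess k V A L w"] eq[of _ w] by auto
  qed
  also have "\<dots> = 2 * (\<Sum>w\<in>V. saved k V A L B g w)" by (rule sum_distrib_left[symmetric])
  finally show False using R by simp
qed

section \<open>Using up one colour class\<close>

text \<open>In the application \<open>s\<close> and \<open>s'\<close> are the drops before and after the removal of one clique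
vertex, and \<open>e\<close> is the excess. If no vertex loses anything, then any class will do. Otherwise exactly
one vertex \<open>v\<^sub>0\<close> loses one, and a class avoiding \<open>v\<^sub>0\<close> must make up for it by having \<open>s < e\<close> in total.
A class with two vertices does: its \<open>e\<close> is at least \<open>2k\<close>, whereas the sum of \<open>s\<close> over all vertices is
at most \<open>2k\<close>, and \<open>v\<^sub>0\<close> contributes to it.\<close>

lemma exists_class_within_budget:
  fixes s s' e :: "'a \<Rightarrow> nat"
  assumes fin: "finite V" and ne: "V \<noteq> {}"
    and proper: "\<And>u v. u \<in> V \<Longrightarrow> v \<in> V \<Longrightarrow> E u v \<Longrightarrow> c u \<noteq> c v"
    and degree: "\<And>v. v \<in> V \<Longrightarrow> card (c ` V) \<le> deg V v"
    and se: "\<And>v. v \<in> V \<Longrightarrow> s v \<le> e v" and ke: "\<And>v. v \<in> V \<Longrightarrow> k \<le> e v"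
    and sum: "(\<Sum>v\<in>V. s v) \<le> 2 * k" and loss: "(\<Sum>v\<in>V. s v - s' v) \<le> 1"
  shows "\<exists>j\<in>c ` V. (\<forall>u\<in>V. c u = j \<longrightarrow> s u \<le> s' u) \<and>
           (\<Sum>v\<in>V. s v) \<le> (\<Sum>v\<in>{v\<in>V. c v = j}. e v) + (\<Sum>v\<in>{v\<in>V. c v \<noteq> j}. s' v)"
proof -
  have split: "(\<Sum>v\<in>V. s v) = (\<Sum>v\<in>{v\<in>V. c v = j}. s v) + (\<Sum>v\<in>{v\<in>V. c v \<noteq> j}. s v)" for j
    using fin by (subst sum.union_disjoint[symmetric]) (auto intro: sum.cong)
  have seU: "(\<Sum>v\<in>{v\<in>V. c v = j}. s v) \<le> (\<Sum>v\<in>{v\<in>V. c v = j}. e v)" for j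
    by (intro sum_mono se) auto
  show ?thesis
  proof (cases "\<forall>v\<in>V. s v \<le> s' v")
    case True
    obtain v where "v \<in> V" using ne by auto
    have "(\<Sum>v\<in>{v\<in>V. c v \<noteq> j}. s v) \<le> (\<Sum>v\<in>{v\<in>V. c v \<noteq> j}. s' v)" for j
      using True by (intro sum_mono) auto
    then show ?thesis using True \<open>v \<in> V\<close> split[of "c v"] seU[of "c v"]
      by (intro bexI[of _ "c v"]) (auto intro: add_mono)
  next
    case False
    then obtain v0 where v0: "v0 \<in> V" "s' v0 < s v0" by force
    have eq: "(\<Sum>v\<in>V. s v - s' v) = (s v0 - s' v0) + (\<Sum>v\<in>V - {v0}. s v - s' v)"
      using fin v0(1) by (rule sum.remove)
    then have "(\<Sum>v\<in>V - {v0}. s v - s' v) = 0" and one: "s v0 \<le> s' v0 + 1" using loss v0 by auto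
    then have others: "s v \<le> s' v" if "v \<in> V" "v \<noteq> v0" for v using fin that by auto
    let ?Nb = "{w\<in>V. E v0 w}"
    \<comment> \<open>Pigeonhole: there are more neighbours of \<open>v0\<close> than classes that avoid \<open>v0\<close>.\<close>
    have "c ` ?Nb \<subseteq> c ` V - {c v0}" using proper[OF v0(1)] by force
    then have "card (c ` ?Nb) \<le> card (c ` V - {c v0})" using fin by (intro card_mono) auto
    also have "\<dots> < card (c ` V)" using fin v0 by (intro card_Diff1_less) auto
    also have "\<dots> \<le> card ?Nb" using degree[OF v0(1)] unfolding deg_def .
    finally have "\<not> inj_on c ?Nb" using card_image by fastforce
    then obtain u1 u2 where u: "u1 \<in> ?Nb" "u2 \<in> ?Nb" "u1 \<noteq> u2" "c u1 = c u2" unfolding inj_on_def by blast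
    define j where "j = c u1"
    have jv: "c v0 \<noteq> j" using u(1) proper[OF v0(1)] unfolding j_def by auto
    have "2 * k \<le> e u1 + e u2" using ke[of u1] ke[of u2] u by auto
    also have "\<dots> = (\<Sum>v\<in>{u1, u2}. e v)" using u by simp
    also have "\<dots> \<le> (\<Sum>v\<in>{v\<in>V. c v = j}. e v)"
      using fin u unfolding j_def by (intro sum_mono2) auto
    finally have e2: "2 * k \<le> (\<Sum>v\<in>{v\<in>V. c v = j}. e v)" .
    have r: "(\<Sum>v\<in>{v\<in>V. c v \<noteq> j}. f v) = f v0 + (\<Sum>v\<in>{v\<in>V. c v \<noteq> j} - {v0}. f v)" for f :: "'a \<Rightarrow> nat"
      using fin v0(1) jv by (intro sum.remove) auto
    have le: "(\<Sum>v\<in>{v\<in>V. c v \<noteq> j} - {v0}. s v) \<le> (\<Sum>v\<in>{v\<in>V. c v \<noteq> j} - {v0}. s' v)"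
      by (intro sum_mono others) auto
    have "(\<Sum>v\<in>{v\<in>V. c v = j}. s v) < (\<Sum>v\<in>{v\<in>V. c v = j}. e v)"
      using split[of j] r[of s] sum v0(2) e2 by simp
    then have "(\<Sum>v\<in>V. s v) \<le> (\<Sum>v\<in>{v\<in>V. c v = j}. e v) + (\<Sum>v\<in>{v\<in>V. c v \<noteq> j}. s' v)"
      using split[of j] r[of s] r[of s'] le one by simp
    moreover have "j \<in> c ` V" using u unfolding j_def by auto
    moreover have "\<forall>u\<in>V. c u = j \<longrightarrow> s u \<le> s' u" using others jv by auto
    ultimately show ?thesis by blast
  qed
qed

text \<open>The step that uses up the class \<open>j\<close>. The assumption \<open>maximal\<close> keeps every list of a clique vertex
from losing more than \<open>|B|\<close> elements, \<open>lossless\<close> keeps the elements chosen on \<open>B - {b}\<close> compatible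
with the neighbours of the element chosen at \<open>b\<close>, and \<open>budget\<close> pays for the \<open>|B| - 1\<close> clique vertices
that are coloured.\<close>

lemma feasible_precolour_class:
  assumes feas: "feasible k c V A L" and k: "1 \<le> k"
    and tight: "\<And>v. v \<in> V \<Longrightarrow> card (L v) \<le> deg V v + card A"
    and ex: "\<And>a x v. a \<in> A \<Longrightarrow> x \<in> L a \<Longrightarrow> v \<in> V \<Longrightarrow> \<exists>y\<in>L v. N x y"
    and B: "B \<subseteq> A" and g: "colours B L g" and b: "b \<in> B"
    and maximal: "\<And>a x v y. \<lbrakk>a \<in> A - B; x \<in> L a; \<forall>b'\<in>B. \<not> N (g b') x; v \<in> V;
        card B - card (blocked L B g v) < excess k V A L v; y \<in> blocked L B g v\<rbrakk> \<Longrightarrow> \<not> N x y"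
    and proper: "\<And>u v. u \<in> V \<Longrightarrow> v \<in> V \<Longrightarrow> E u v \<Longrightarrow> c u \<noteq> c v"
    and j: "j \<in> c ` V"
    and lossless: "\<And>u. u \<in> V \<Longrightarrow> c u = j \<Longrightarrow> saved k V A L B g u \<le> saved k V A L (B - {b}) g u"
    and budget: "card B - 1 \<le> (\<Sum>v\<in>{v\<in>V. c v = j}. excess k V A L v)
                   + (\<Sum>v\<in>{v\<in>V. c v \<noteq> j}. saved k V A L (B - {b}) g v)"
  shows "\<exists>U B' p. U \<subseteq> V \<and> B' \<subseteq> A \<and> U \<union> B' \<noteq> {} \<and> colours (U \<union> B') L p \<and>
           feasible k c (V - U) (A - B') (residual L (U \<union> B') p)"
proof -
  have v: "covers V A L" using feas unfolding feasible_def by auto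
  have fin: "finite V" "finite A" "finite B"
    using covers_finite(1,2)[OF v] finite_subset[OF B] by auto
  note dis = covers_finite(3)[OF v]
  define B' where "B' = B - {b}"
  define W where "W = {v\<in>V. c v = j}"
  \<comment> \<open>The other vertices of the class \<open>W\<close> will have excess zero, so they are left for later.\<close>
  define U where "U = {u\<in>W. card B - card (blocked L B g u) < excess k V A L u}"
  define p where "p = (\<lambda>w. if w \<in> B then g w else nbr L g w b)"
  have UV: "U \<subseteq> V" "U \<subseteq> W" "W \<subseteq> V" unfolding U_def W_def by auto
  have B'B: "B' \<subseteq> B" "B' \<subseteq> A" using B unfolding B'_def by auto
  have pB: "p w = g w" if "w \<in> B" for w using that unfolding p_def by simp
  have pV: "p w = nbr L g w b" if "w \<in> V" for w using that B dis unfolding p_def by auto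
  have gB: "g w \<in> L w" if "w \<in> B" for w using g that unfolding colours_def by auto
  have exB: "\<exists>z\<in>L w. N (g a) z" if "a \<in> B" "w \<in> V" for a w using ex gB B that by blast
  have nb: "nbr L g w a \<in> L w" "N (g a) (nbr L g w a)" if "a \<in> B" "w \<in> V" for a w
    using nbr_spec[of L w g a, OF exB[OF that]] by auto
  have eq: "saved k V A L C g w = min (redundancy (nbr L g w) C) (excess k V A L w)"
    if "C \<subseteq> B" "w \<in> V" for C w
    using saved_eq_redundancy[OF v _ colours_subset[OF g that(1)] that(2)] B exB that by blast
  have saved_p: "saved k V A L B' p w = saved k V A L (B - {b}) g w" for w
    unfolding B'_def by (rule saved_cong) (auto simp: pB)
  \<comment> \<open>If the neighbour were shared, then removing \<open>b\<close> would lower the drop at \<open>u\<close>, which is below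
    its cap because \<open>u\<close> is in \<open>U\<close>.\<close>
  have priv: "nbr L g u b' \<noteq> nbr L g u b" if "u \<in> U" "b' \<in> B'" for u b'
  proof (rule private_if_capped_lossless[OF fin(3) b, where h = "nbr L g u" and e = "excess k V A L u"])
    have u: "u \<in> V" "c u = j" using that UV unfolding W_def by auto
    show "redundancy (nbr L g u) B < excess k V A L u"
      using that blocked_eq_nbr[OF v B g u(1) exB[OF _ u(1)]] unfolding U_def redundancy_def by simp
    show "min (redundancy (nbr L g u) B) (excess k V A L u)
       \<le> min (redundancy (nbr L g u) (B - {b})) (excess k V A L u)"
      using lossless[OF u] eq[of _ u] u(1) by simp
  qed (use that in \<open>auto simp: B'_def\<close>)
  have free: "\<not> N (p b') (p u)" if "u \<in> U" "b' \<in> B'" for u b'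
  proof
    assume "N (p b') (p u)"
    then have "N (g b') (nbr L g u b)" using that UV pV[of u] pB[of b'] B'B by (metis subsetD)
    moreover have "b' \<in> A" "u \<in> V" "g b' \<in> L b'" "nbr L g u b \<in> L u"
      using that UV B'B gB nb(1)[OF b] by auto
    ultimately have "nbr L g u b' = nbr L g u b"
      using nbr_eqI[where g = g and b = b' and z = "nbr L g u b" and v = u, OF v]
        \<open>N (g b') (nbr L g u b)\<close> by auto
    then show False using priv[OF that] by blast
  qed
  have indep: "\<not> N (p u) (p w)" if "u \<in> U" "w \<in> U" "u \<noteq> w" for u w
  proof
    assume "N (p u) (p w)"
    moreover have uw: "u \<in> V" "w \<in> V" "c u = c w" using that UV unfolding W_def by auto
    moreover have "p u \<in> L u" "p w \<in> L w" using nb(1)[OF b] pV uw by auto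
    ultimately show False using covers_adjacent[OF v _ _ that(3)] proper by blast
  qed
  have colours: "colours (U \<union> B') L p"
    unfolding colours_def
  proof (intro conjI ballI impI)
    fix u assume "u \<in> U \<union> B'"
    then show "p u \<in> L u" using nb(1)[OF b] pV pB gB UV B'B by (metis UnE subsetD)
  next
    fix u w assume uw: "u \<in> U \<union> B'" "w \<in> U \<union> B'" "u \<noteq> w"
    have "\<not> N (p u) (p w)" if "u \<in> B'" "w \<in> B'"
      using that g uw(3) pB B'B unfolding colours_def by (metis subsetD)
    then show "\<not> N (p u) (p w)" using uw indep free N_sym by (metis UnE)
  qed
  \<comment> \<open>All elements on \<open>U\<close> are neighbours of the single element \<open>g b\<close>; hence in \<open>L b\<close> they block only
    \<open>g b\<close>, and elsewhere, by \<open>maximal\<close>, only elements that \<open>g\<close> on \<open>B\<close> blocks as well.\<close>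
  have loss: "card (blocked L (U \<union> B') p a) \<le> card B' + 1" if a: "a \<in> A - B'" for a
  proof (cases "a = b")
    case True
    have "blocked L (U \<union> B') p a \<subseteq> insert (g b) (blocked L B' g a)"
    proof
      fix z assume "z \<in> blocked L (U \<union> B') p a"
      then obtain w where w: "w \<in> U \<union> B'" "N (p w) z" "z \<in> L b" unfolding blocked_def True by auto
      show "z \<in> insert (g b) (blocked L B' g a)"
      proof (cases "w \<in> B'")
        case False
        then have "w \<in> V" "w \<in> U" using w UV by auto
        moreover have "w \<noteq> b" using \<open>w \<in> V\<close> b B dis by auto
        ultimately have "z = g b"
          using covers_unique[OF v, of w b "p w" z "g b"] w nb[OF b \<open>w \<in> V\<close>] pV b B gB N_sym by auto
        then show ?thesis by simp
      qed (use w pB B'B True in \<open>auto simp: blocked_def\<close>)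
    qed
    moreover have "finite (blocked L B' g a)"
      using covers_finite(4)[OF v, of a] a unfolding blocked_def by auto
    moreover have "card (blocked L B' g a) \<le> card B'"
      using card_blocked_colours[OF v _ colours_subset[OF g B'B(1)]] a B'B(2) by auto
    ultimately show ?thesis
      using card_mono[of "insert (g b) (blocked L B' g a)" "blocked L (U \<union> B') p a"]
      by (simp add: card_insert_if split: if_splits)
  next
    case False
    then have aB: "a \<in> A - B" using a unfolding B'_def by auto
    have "blocked L (U \<union> B') p a \<subseteq> blocked L B g a"
    proof
      fix z assume "z \<in> blocked L (U \<union> B') p a"
      then obtain w where w: "w \<in> U \<union> B'" "N (p w) z" "z \<in> L a" unfolding blocked_def by auto
      show "z \<in> blocked L B g a"
      proof (cases "w \<in> B'")
        case False
        then have wU: "w \<in> V" "w \<in> U" using w UV by auto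
        have "nbr L g w b \<in> blocked L B g w" using nb[OF b wU(1)] b unfolding blocked_def by auto
        moreover have "N z (nbr L g w b)" using w(2) pV[OF wU(1)] N_sym by auto
        ultimately have "\<not> (\<forall>b'\<in>B. \<not> N (g b') z)"
          using maximal[OF aB w(3) _ wU(1)] wU(2) unfolding U_def by blast
        then show ?thesis using w(3) unfolding blocked_def by auto
      qed (use w pB B'B in \<open>fastforce simp: blocked_def\<close>)
    qed
    moreover have "card (blocked L B g a) \<le> card B"
      using card_blocked_colours[OF v _ g] aB B by auto
    moreover have "finite (blocked L B g a)" using covers_finite(4)[OF v, of a] a unfolding blocked_def by auto
    moreover have "card B = card B' + 1" using fin(3) b unfolding B'_def by (metis Suc_eq_plus1 card.remove)
    ultimately show ?thesis by (metis card_mono order_trans)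
  qed
  have sat: "excess k V A L u \<le> saved k V A L B' p u" if "u \<in> W - U" for u
  proof -
    have "u \<in> V" "c u = j" using that unfolding W_def by auto
    from lossless[OF this] show ?thesis using that saved_p[of u] unfolding U_def saved_def[of k V A L B g] by auto
  qed
  have pos: "0 < excess k V A L u" if "u \<in> V" for u
    using tight[OF that] k unfolding excess_def by simp
  have "{u\<in>V. 0 < excess k V A L u} = V" using pos by auto
  moreover have "card (c ` {u\<in>V - U. saved k V A L B' p u < excess k V A L u}) + 1 \<le> card (c ` V)"
  proof -
    have "c ` {u\<in>V - U. saved k V A L B' p u < excess k V A L u} \<subseteq> c ` V - {j}"
      using sat unfolding W_def by force
    then have "card (c ` {u\<in>V - U. saved k V A L B' p u < excess k V A L u}) \<le> card (c ` V - {j})"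
      using fin by (intro card_mono) auto
    also have "\<dots> < card (c ` V)" using fin j by (intro card_Diff1_less) auto
    finally show ?thesis by simp
  qed
  ultimately have act: "card (c ` {u\<in>V - U. saved k V A L B' p u < excess k V A L u}) + 1
                \<le> card (c ` {u\<in>V. 0 < excess k V A L u})" by simp
  have cB: "card B' = card B - 1" using b fin(3) unfolding B'_def by simp
  let ?S = "\<Sum>u\<in>V - U. excess k V A L u - saved k V A L B' p u"
  have "?S = (\<Sum>u\<in>V - W. excess k V A L u - saved k V A L B' p u)"
    using fin UV sat by (intro sum.mono_neutral_right) auto
  moreover have "(\<Sum>u\<in>V - W. excess k V A L u - saved k V A L B' p u) + (\<Sum>u\<in>V - W. saved k V A L B' p u)
      = (\<Sum>u\<in>V - W. excess k V A L u)"
    by (subst sum.distrib[symmetric], rule sum.cong) (auto simp: saved_def)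
  moreover have "(\<Sum>u\<in>V. excess k V A L u) = (\<Sum>u\<in>V - W. excess k V A L u) + (\<Sum>u\<in>W. excess k V A L u)"
    using fin UV by (intro sum.subset_diff) auto
  moreover have "V - W = {v\<in>V. c v \<noteq> j}" unfolding W_def by auto
  then have "card B' \<le> (\<Sum>u\<in>W. excess k V A L u) + (\<Sum>u\<in>V - W. saved k V A L B' p u)"
    using budget unfolding cB by (simp add: saved_p W_def)
  ultimately have S: "?S + card B' \<le> (\<Sum>u\<in>V. excess k V A L u)" by linarith
  have "(2 * k + 2) * ?S + (2 * k + 1) * card B' \<le> (2 * k + 2) * (?S + card B')"
    by (simp add: algebra_simps)
  also have "\<dots> \<le> (2 * k + 2) * (\<Sum>u\<in>V. excess k V A L u)" using S by (rule mult_le_mono2)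
  also have "\<dots> \<le> (2 * k + 1) * card A" using feas unfolding feasible_def by auto
  finally have bud: "(2 * k + 2) * ?S \<le> (2 * k + 1) * (card A - card B')"
    by (simp only: diff_mult_distrib2)
  have "feasible k c (V - U) (A - B') (residual L (U \<union> B') p)"
    by (rule feasible_precolour[OF feas B'B(2) UV(1) colours act loss bud])
  moreover have "U \<union> B' \<noteq> {}"
  proof
    assume empty: "U \<union> B' = {}"
    obtain u where u: "u \<in> W" using j unfolding W_def by auto
    then have "excess k V A L u \<le> saved k V A L B' p u" using sat empty by auto
    also have "\<dots> = 0" using empty unfolding saved_def by simp
    finally show False using pos[of u] u UV by auto
  qed
  ultimately show ?thesis using UV B'B colours by blast
qed

section \<open>The induction\<close>

text \<open>A new clique vertex blocks exactly one element \<open>y\<close> of \<open>L w\<close>. So the drop never decreases, and it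
increases if \<open>y\<close> was blocked before, unless it has already reached its cap.\<close>

lemma saved_insert:
  assumes v: "covers V A L" and B: "B \<subseteq> A" and g: "colours B L g" and a: "a \<in> A - B" and x: "x \<in> L a"
    and w: "w \<in> V" and y: "y \<in> L w" "N x y"
  shows "saved k V A L B g w \<le> saved k V A L (insert a B) (g(a := x)) w"
    and "y \<in> blocked L B g w \<Longrightarrow> card B - card (blocked L B g w) < excess k V A L w \<Longrightarrow>
           saved k V A L B g w < saved k V A L (insert a B) (g(a := x)) w"
proof -
  have fB: "finite B" using finite_subset[OF B covers_finite(2)[OF v]] .
  have wA: "w \<noteq> a" "w \<notin> B" using w a B covers_finite(3)[OF v] by auto
  have uniq: "z = y" if "z \<in> L w" "N x z" for z
    using covers_unique[OF v, of a w x z y] that x y w a wA by auto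
  have "blocked L (insert a B) (g(a := x)) w = {z\<in>L w. N x z} \<union> blocked L B (g(a := x)) w"
    unfolding blocked_def by auto
  also have "blocked L B (g(a := x)) w = blocked L B g w" using a by (intro blocked_cong) auto
  also have "{z\<in>L w. N x z} = {y}" using y uniq by blast
  finally have h: "blocked L (insert a B) (g(a := x)) w = insert y (blocked L B g w)"
    by (simp add: fun_upd_def)
  have fin: "finite (blocked L B g w)" using covers_finite(4)[OF v, of w] w unfolding blocked_def by auto
  have c: "card (insert a B) = Suc (card B)" using fB a by simp
  have le: "card (blocked L B g w) \<le> card B" using card_blocked_colours[OF v _ g] B w wA by auto
  show "saved k V A L B g w \<le> saved k V A L (insert a B) (g(a := x)) w"
    using c card_insert_le_m1[of "Suc (card (blocked L B g w))" "blocked L B g w" y] unfolding saved_def h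
    by (intro min.mono) simp_all
  show "saved k V A L B g w < saved k V A L (insert a B) (g(a := x)) w"
    if "y \<in> blocked L B g w" "card B - card (blocked L B g w) < excess k V A L w"
    using c that le unfolding saved_def h by (simp add: insert_absorb)
qed

text \<open>If no partial colouring of the clique alone can be split off, then a partial colouring of maximal
size among those with drop at least \<open>|B| - 1\<close> meets all requirements of
\<open>feasible_precolour_class\<close>.\<close>

lemma exists_feasible_precolouring:
  assumes feas: "feasible k c V A L" and k: "1 \<le> k" and ne: "V \<noteq> {}"
    and tight: "\<And>v. v \<in> V \<Longrightarrow> card (L v) \<le> deg V v + card A"
    and proper: "\<And>u v. u \<in> V \<Longrightarrow> v \<in> V \<Longrightarrow> E u v \<Longrightarrow> c u \<noteq> c v"
  shows "\<exists>U B p. U \<subseteq> V \<and> B \<subseteq> A \<and> U \<union> B \<noteq> {} \<and> colours (U \<union> B) L p \<and>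
           feasible k c (V - U) (A - B) (residual L (U \<union> B) p)"
proof (rule ccontr)
  assume none: "\<not> ?thesis"
  have v: "covers V A L" using feas unfolding feasible_def by auto
  note fin = covers_finite(1,2)[OF v]
  note dis = covers_finite(3)[OF v]
  define R where "R B g = (\<Sum>w\<in>V. saved k V A L B g w)" for B g
  have irred: "(2 * k + 2) * R B g < (2 * k + 1) * card B" if "B \<subseteq> A" "B \<noteq> {}" "colours B L g" for B g
  proof (rule ccontr)
    assume "\<not> ?thesis"
    then have "feasible k c (V - {}) (A - B) (residual L ({} \<union> B) g)"
      using feasible_precolour_clique[OF feas that(1,3)] unfolding R_def by simp
    then show False using none that by (metis empty_subsetI sup_bot_left)
  qed
  have pos: "k \<le> excess k V A L u" "0 < excess k V A L u" if "u \<in> V" for u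
    using tight[OF that] k unfolding excess_def by auto
  have single: "colours {a} L (\<lambda>_. x)" if "x \<in> L a" for a x using that unfolding colours_def by auto
  have ex: "\<exists>y\<in>L w. N x y" if "a \<in> A" "x \<in> L a" "w \<in> V" for a x w
  proof -
    have "(2 * k + 2) * R {a} (\<lambda>_. x) < 2 * k + 1" using irred[OF _ _ single[OF that(2)]] that by simp
    then have "R {a} (\<lambda>_. x) = 0" by (cases "R {a} (\<lambda>_. x)") auto
    then have "saved k V A L {a} (\<lambda>_. x) w = 0" using fin that unfolding R_def by simp
    then have "blocked L {a} (\<lambda>_. x) w \<noteq> {}" using pos(2)[OF that(3)] unfolding saved_def by auto
    then show ?thesis unfolding blocked_def by auto
  qed
  have act: "{u\<in>V. 0 < excess k V A L u} = V" using pos by auto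
  have big: "card A + card (c ` V) \<le> card (L a)" if "a \<in> A" for a
    using feas that unfolding feasible_def act by auto
  have Ane: "A \<noteq> {}"
  proof
    assume "A = {}"
    then have "(\<Sum>u\<in>V. excess k V A L u) = 0" using feas unfolding feasible_def by simp
    then show False using pos(2) ne fin by auto
  qed
  then obtain a0 where a0: "a0 \<in> A" by auto
  \<comment> \<open>Distinct elements of \<open>L a0\<close> have distinct neighbours in \<open>L w\<close>, so \<open>L w\<close> is as long as \<open>L a0\<close>.\<close>
  have degree: "card (c ` V) \<le> deg V w" if w: "w \<in> V" for w
  proof -
    obtain y where y: "\<And>x. x \<in> L a0 \<Longrightarrow> y x \<in> L w \<and> N x (y x)" using ex[OF a0 _ w] by metis
    have "inj_on y (L a0)"
    proof (rule inj_onI)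
      fix x x' assume *: "x \<in> L a0" "x' \<in> L a0" "y x = y x'"
      have "N (y x) x" "N (y x) x'" using y[OF *(1)] y[OF *(2)] *(3) N_sym by auto
      moreover have "w \<noteq> a0" using w a0 dis by auto
      ultimately show "x = x'" using covers_unique[OF v, of w a0 "y x" x x'] w a0 y * by auto
    qed
    moreover have "y ` L a0 \<subseteq> L w" using y by auto
    ultimately have "card (L a0) \<le> card (L w)"
      using card_inj_on_le covers_finite(4)[OF v, of w] w by blast
    then show ?thesis using big[OF a0] tight[OF w] by linarith
  qed
  \<comment> \<open>A single clique vertex satisfies \<open>P\<close> with drop zero, so the maximum below is over a nonempty set.\<close>
  define P where "P = (\<lambda>(B, g). B \<subseteq> A \<and> B \<noteq> {} \<and> colours B L g \<and> card B \<le> R B g + 1)"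
  have "L a0 \<noteq> {}" using big[OF a0] a0 fin by (auto simp: card_gt_0_iff)
  then obtain x0 where "x0 \<in> L a0" by auto
  then have "P ({a0}, \<lambda>_. x0)" using single a0 unfolding P_def by auto
  moreover have "\<forall>z. P z \<longrightarrow> card (fst z) < Suc (card A)"
    using fin unfolding P_def by (auto simp: less_Suc_eq_le intro: card_mono)
  ultimately obtain B g where Bg: "P (B, g)" and mx: "\<And>B' g'. P (B', g') \<Longrightarrow> card B' \<le> card B"
    using ex_has_greatest_nat[of P "({a0}, \<lambda>_. x0)" "\<lambda>z. card (fst z)"] by (metis fst_conv prod.collapse)
  have B: "B \<subseteq> A" "B \<noteq> {}" and g: "colours B L g" and RB: "card B \<le> R B g + 1"
    using Bg unfolding P_def by auto
  have fB: "finite B" using finite_subset[OF B(1) fin(2)] .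
  have ir: "(2 * k + 2) * R B g < (2 * k + 1) * card B" by (rule irred[OF B g])
  have R1: "R B g < card B"
  proof (rule ccontr)
    assume "\<not> ?thesis"
    then have "(2 * k + 1) * card B \<le> (2 * k + 2) * R B g" by (intro mult_mono) auto
    then show False using ir by simp
  qed
  \<comment> \<open>Here the factor \<open>(2k + 2) / (2k + 1)\<close> matters: it makes a drop of \<open>2k + 1\<close> pay for \<open>2k + 2\<close> clique
    vertices, and these could be split off. So the drop of \<open>B\<close> stays below \<open>2k + 1\<close>.\<close>
  have "(2 * k + 2) * R B g < (2 * k + 1) * (R B g + 1)"
    using ir mult_le_mono2[OF RB, of "2 * k + 1"] by linarith
  then have R2: "R B g \<le> 2 * k" by (simp add: algebra_simps)
  have exB: "\<exists>z\<in>L w. N (g b) z" if "b \<in> B" "w \<in> V" for b w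
    using ex that g B unfolding colours_def by blast
  obtain b where b: "b \<in> B" "(\<Sum>w\<in>V. saved k V A L B g w - saved k V A L (B - {b}) g w) \<le> 1"
    using exists_removal_losing_at_most_one[OF v B(1) g exB] R1 unfolding R_def by blast
  obtain j where j: "j \<in> c ` V"
      "\<And>u. u \<in> V \<Longrightarrow> c u = j \<Longrightarrow> saved k V A L B g u \<le> saved k V A L (B - {b}) g u"
      "R B g \<le> (\<Sum>v\<in>{v\<in>V. c v = j}. excess k V A L v)
          + (\<Sum>v\<in>{v\<in>V. c v \<noteq> j}. saved k V A L (B - {b}) g v)"
    using exists_class_within_budget[where c = c and k = k and s = "saved k V A L B g"
        and s' = "saved k V A L (B - {b}) g" and e = "excess k V A L", OF fin(1) ne proper degree _ pos(1) _ b(2)]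
      R2 unfolding R_def saved_def[of k V A L B g] by auto
  have maximal: "\<not> N x y" if *: "a \<in> A - B" "x \<in> L a" "\<forall>b'\<in>B. \<not> N (g b') x" "w \<in> V"
        "card B - card (blocked L B g w) < excess k V A L w" "y \<in> blocked L B g w" for a x w y
  proof
    assume N: "N x y"
    let ?B = "insert a B" and ?g = "g(a := x)"
    have yw: "y \<in> L w" using *(6) unfolding blocked_def by auto
    have "colours ?B L ?g"
      unfolding colours_def
    proof (intro conjI ballI impI)
      fix u assume "u \<in> ?B"
      then show "?g u \<in> L u" using g *(2) unfolding colours_def by auto
    next
      fix u w assume uw: "u \<in> ?B" "w \<in> ?B" "u \<noteq> w"
      have "\<not> N (g u) (g w)" if "u \<in> B" "w \<in> B"
        using g that uw(3) unfolding colours_def by blast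
      moreover have "\<not> N x (g b')" if "b' \<in> B" for b' using *(3) N_sym that by blast
      ultimately show "\<not> N (?g u) (?g w)" using uw *(3) by auto
    qed
    moreover have "R B g < R ?B ?g" unfolding R_def
    proof (rule sum_strict_mono_ex1[OF fin(1)])
      show "\<forall>w\<in>V. saved k V A L B g w \<le> saved k V A L ?B ?g w"
        using saved_insert(1)[OF v B(1) g *(1,2)] ex[of a x] *(1,2) by blast
      show "\<exists>w\<in>V. saved k V A L B g w < saved k V A L ?B ?g w"
        using saved_insert(2)[OF v B(1) g *(1,2,4) yw N *(6,5)] *(4) by blast
    qed
    moreover have "card ?B = card B + 1" using fB *(1) by simp
    ultimately have "P (?B, ?g)" using B(1) *(1) RB unfolding P_def by auto
    then show False using mx[of ?B ?g] \<open>card ?B = card B + 1\<close> by simp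
  qed
  have "card B - 1 \<le> (\<Sum>v\<in>{v\<in>V. c v = j}. excess k V A L v)
          + (\<Sum>v\<in>{v\<in>V. c v \<noteq> j}. saved k V A L (B - {b}) g v)" using j(3) RB by linarith
  note budget = this
  have "\<exists>U B' p. U \<subseteq> V \<and> B' \<subseteq> A \<and> U \<union> B' \<noteq> {} \<and> colours (U \<union> B') L p \<and>
           feasible k c (V - U) (A - B') (residual L (U \<union> B') p)"
  proof (rule feasible_precolour_class[where B = B and g = g and b = b and j = j])
    show "\<And>a x v. a \<in> A \<Longrightarrow> x \<in> L a \<Longrightarrow> v \<in> V \<Longrightarrow> \<exists>y\<in>L v. N x y" by (rule ex)
    show "\<And>a x v y. \<lbrakk>a \<in> A - B; x \<in> L a; \<forall>b'\<in>B. \<not> N (g b') x; v \<in> V;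
        card B - card (blocked L B g v) < excess k V A L v; y \<in> blocked L B g v\<rbrakk> \<Longrightarrow> \<not> N x y"
      by (rule maximal)
    show "\<And>u v. u \<in> V \<Longrightarrow> v \<in> V \<Longrightarrow> E u v \<Longrightarrow> c u \<noteq> c v" by (rule proper)
  qed (fact feas k tight B(1) g b(1) j(1) j(2) budget)+
  then show False using none by contradiction
qed

theorem feasible_colours:
  assumes "feasible k c V A L" "1 \<le> k"
    and "\<And>u v. u \<in> V \<Longrightarrow> v \<in> V \<Longrightarrow> E u v \<Longrightarrow> c u \<noteq> c v"
  shows "\<exists>f. colours (V \<union> A) L f"
  using assms(1,3)
proof (induction "card V + card A" arbitrary: V A L rule: less_induct)
  case less
  note feas = less.prems(1) and proper = less.prems(2)
  have v: "covers V A L" using feas unfolding feasible_def by auto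
  note fin = covers_finite(1,2)[OF v]
  note dis = covers_finite(3)[OF v]
  consider "V = {}" | w where "w \<in> V" "deg V w + card A < card (L w)"
    | "V \<noteq> {}" "\<And>w. w \<in> V \<Longrightarrow> card (L w) \<le> deg V w + card A"
    by (meson not_le)
  then show ?case
  proof cases
    case 1
    then show ?thesis using colours_clique[OF v] feas unfolding feasible_def by fastforce
  next
    case (2 w)
    let ?W = "(V - {w}) \<union> A" and ?T = "{u\<in>V - {w}. E w u} \<union> A"
    have "card (V - {w}) < card V" using 2(1) fin by (intro card_Diff1_less) auto
    then obtain f where f: "colours ?W L f"
      using less.hyps[OF _ feasible_delete[OF feas 2(1)]] proper by force
    have wW: "w \<notin> ?W" using 2(1) dis by auto
    have "card (blocked L ?W f w) \<le> card ?T"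
    proof (rule card_blocked_le)
      show "finite ?T" using fin by simp
      fix u z assume *: "u \<in> ?W" "z \<in> L w" "N (f u) z"
      have fu: "f u \<in> L u" using f *(1) unfolding colours_def by auto
      show "u \<in> ?T"
      proof (cases "u \<in> A")
        case False
        then have "E w u"
          using covers_adjacent[OF v, of w u z "f u"] * 2(1) fu N_sym by auto
        then show ?thesis using False * by auto
      qed auto
    next
      fix u z z' assume *: "u \<in> ?T" "z \<in> L w" "z' \<in> L w" "N (f u) z" "N (f u) z'"
      have "u \<in> ?W" using * by auto
      then have "f u \<in> L u" "u \<noteq> w" "u \<in> V \<union> A" using f wW unfolding colours_def by auto
      then show "z = z'" using covers_unique[OF v, of u w "f u" z z'] * 2(1) by auto
    qed
    also have "\<dots> \<le> card {u\<in>V - {w}. E w u} + card A" by (rule card_Un_le)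
    also have "card {u\<in>V - {w}. E w u} \<le> deg V w" unfolding deg_def using fin by (intro card_mono) auto
    finally have "card (blocked L ?W f w) < card (L w)" using 2(2) by simp
    moreover have "finite (L w)" using covers_finite(4)[OF v] 2(1) by auto
    moreover have "insert w ?W = V \<union> A" using 2(1) by auto
    ultimately show ?thesis using colours_insert[OF f wW] by metis
  next
    case 3
    obtain U B p where *: "U \<subseteq> V" "B \<subseteq> A" "U \<union> B \<noteq> {}" "colours (U \<union> B) L p"
        "feasible k c (V - U) (A - B) (residual L (U \<union> B) p)"
      using exists_feasible_precolouring[OF feas assms(2) 3 proper] by blast
    have "card (V - U) \<le> card V" "card (A - B) \<le> card A"
      using fin by (auto intro: card_mono)
    moreover have "card (V - U) < card V \<or> card (A - B) < card A"
    proof -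
      have "V - U \<subset> V \<or> A - B \<subset> A" using *(1-3) by blast
      then show ?thesis using fin psubset_card_mono by blast
    qed
    ultimately have "card (V - U) + card (A - B) < card V + card A" by linarith
    then obtain f where "colours ((V - U) \<union> (A - B)) (residual L (U \<union> B) p) f"
      using less.hyps[OF _ *(5)] proper by force
    moreover have "((V - U) \<union> (A - B)) \<inter> (U \<union> B) = {}" "((V - U) \<union> (A - B)) \<union> (U \<union> B) = V \<union> A"
      using *(1,2) dis by auto
    ultimately show ?thesis using colours_residual[OF *(4)] by metis
  qed
qed

end

section \<open>Covers of joins\<close>

lemma degree_eq_card_neighbours:
  assumes "simple_graph G" "v \<in> verts G"
  shows "degree G v = card {w \<in> verts G. adjacent G v w}"
proof -
  have "bij_betw (\<lambda>w. {v, w}) {w \<in> verts G. adjacent G v w} {e \<in> edges G. v \<in> e}"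
    unfolding bij_betw_def
  proof
    show "inj_on (\<lambda>w. {v, w}) {w \<in> verts G. adjacent G v w}"
      by (rule inj_onI) (auto simp: doubleton_eq_iff)
    show "(\<lambda>w. {v, w}) ` {w \<in> verts G. adjacent G v w} = {e \<in> edges G. v \<in> e}"
    proof
      show "(\<lambda>w. {v, w}) ` {w \<in> verts G. adjacent G v w} \<subseteq> {e \<in> edges G. v \<in> e}"
        unfolding adjacent_def by auto
      show "{e \<in> edges G. v \<in> e} \<subseteq> (\<lambda>w. {v, w}) ` {w \<in> verts G. adjacent G v w}"
      proof
        fix e assume e: "e \<in> {e \<in> edges G. v \<in> e}"
        then have "e \<subseteq> verts G" "card e = 2" using assms(1) unfolding simple_graph_def by auto
        then obtain w where "e = {v, w}" using e by (auto simp: card_2_iff)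
        then show "e \<in> (\<lambda>w. {v, w}) ` {w \<in> verts G. adjacent G v w}"
          using e \<open>e \<subseteq> verts G\<close> unfolding adjacent_def by auto
      qed
    qed
  qed
  from bij_betw_same_card[OF this] show ?thesis unfolding degree_def by simp
qed

lemma not_adjacent_self:
  assumes "simple_graph H"
  shows "\<not> adjacent H x x"
  using assms unfolding simple_graph_def adjacent_def by fastforce

lemma cover_edges_between:
  assumes "cover G (L, H)" "u \<in> verts G" "v \<in> verts G" "u \<noteq> v" "edges_between H (L u) (L v) \<noteq> {}"
  shows "adjacent G u v" "matching (edges_between H (L u) (L v))"
proof -
  have "\<forall>u\<in>verts G. \<forall>v\<in>verts G. u \<noteq> v \<and> \<not> adjacent G u v \<longrightarrow> edges_between H (L u) (L v) = {}"
    and *: "\<forall>u\<in>verts G. \<forall>v\<in>verts G. adjacent G u v \<longrightarrow> matching (edges_between H (L u) (L v))"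
    using assms(1) unfolding cover_def by auto
  then show "adjacent G u v" using assms(2-) by metis
  then show "matching (edges_between H (L u) (L v))" using * assms(2,3) by metis
qed

lemma cover_unique_neighbour:
  assumes "cover G (L, H)" "u \<in> verts G" "v \<in> verts G" "u \<noteq> v"
    and "y \<in> L u" "z \<in> L v" "z' \<in> L v" "adjacent H y z" "adjacent H y z'"
  shows "z = z'"
proof -
  have m: "{y, z} \<in> edges_between H (L u) (L v)" "{y, z'} \<in> edges_between H (L u) (L v)"
    using assms(5-9) unfolding edges_between_def adjacent_def by auto
  then have "matching (edges_between H (L u) (L v))" using cover_edges_between(2)[OF assms(1-4)] by blast
  moreover have "{y, z} \<inter> {y, z'} \<noteq> {}" by simp
  ultimately have "{y, z} = {y, z'}" using m unfolding matching_def by metis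
  then show ?thesis by (auto simp: doubleton_eq_iff)
qed

lemma cover_adjacent:
  assumes "cover G (L, H)" "u \<in> verts G" "v \<in> verts G" "u \<noteq> v"
    and "y \<in> L u" "z \<in> L v" "adjacent H y z"
  shows "adjacent G u v"
proof -
  have "{y, z} \<in> edges_between H (L u) (L v)"
    using assms(5-7) unfolding edges_between_def adjacent_def by auto
  then show ?thesis using cover_edges_between(1)[OF assms(1-4)] by blast
qed

theorem theorem5:
  fixes k :: nat
    and G A :: "'a sgraph"
    and L :: "'a \<Rightarrow> 'b set"
    and H :: "'b sgraph"
  assumes "k \<ge> 1"
    and "simple_graph G"
    and "colorable k G"
    and "complete_graph A"
    and "verts G \<inter> verts A = {}"
    and "cover (join G A) (L, H)"
    and "\<forall>a\<in>verts A. card (L a) \<ge> card (verts A) + chromatic_number G"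
    and "real (card (verts A)) \<ge> (2 * real k + 2) / (2 * real k + 1) *
           (\<Sum>v\<in>verts G. max (real (degree G v) - real (card (L v)) + real (card (verts A)) + real k) 0)"
  shows "cover_colorable (join G A) (L, H)"
proof -
  interpret conflict_system "adjacent G" "adjacent H"
    by unfold_locales (simp add: adjacent_def insert_commute)
  let ?V = "verts G" and ?A = "verts A"
  note cov = assms(6)
  have vJ: "verts (join G A) = ?V \<union> ?A" unfolding join_def by simp
  have sH: "simple_graph H" and LH: "(\<Union>u\<in>?V \<union> ?A. L u) = verts H"
    and disj: "disjoint_family_on L (?V \<union> ?A)"
    using cov unfolding cover_def vJ by auto
  have sA: "simple_graph A" using assms(4) unfolding complete_graph_def by auto
  have finH: "finite (verts H)" using sH unfolding simple_graph_def by auto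
  have finL: "finite (L u)" if "u \<in> ?V \<union> ?A" for u
    using finite_subset[OF _ finH, of "L u"] LH that by auto
  have adjG: "adjacent G u v" if "u \<in> ?V" "v \<in> ?V" "adjacent (join G A) u v" for u v
  proof -
    have "{u, v} \<notin> edges A"
      using that assms(5) sA unfolding simple_graph_def by fastforce
    moreover have "{u, v} \<noteq> {v1, v2}" if "v2 \<in> ?A" for v1 v2
      using that \<open>u \<in> ?V\<close> \<open>v \<in> ?V\<close> assms(5) by (auto simp: doubleton_eq_iff)
    ultimately show ?thesis using that(3) unfolding adjacent_def join_def by auto
  qed
  have covers: "covers ?V ?A L"
    unfolding covers_def
  proof (intro conjI ballI impI)
    show "finite ?V" "finite ?A" using assms(2) sA unfolding simple_graph_def by auto
    show "?V \<inter> ?A = {}" by (rule assms(5))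
  next
    fix u v y z z' assume "u \<in> ?V \<union> ?A" "v \<in> ?V \<union> ?A" "u \<noteq> v" "y \<in> L u" "z \<in> L v" "z' \<in> L v"
      "adjacent H y z" "adjacent H y z'"
    then show "z = z'" using cover_unique_neighbour[OF cov] vJ by metis
  next
    fix u v y z assume "u \<in> ?V" "v \<in> ?V" "u \<noteq> v" "\<not> adjacent G u v" "y \<in> L u" "z \<in> L v"
    then show "\<not> adjacent H y z" using cover_adjacent[OF cov, of u v y z] vJ adjG by auto
  qed (rule finL)
  note finV = covers_finite(1)[OF covers]
  have "colorable (chromatic_number G) G"
    unfolding chromatic_number_def using assms(3) by (rule LeastI)
  then obtain c :: "'a \<Rightarrow> nat" where c: "c ` ?V \<subseteq> {1..chromatic_number G}"
      "\<And>u v. u \<in> ?V \<Longrightarrow> v \<in> ?V \<Longrightarrow> adjacent G u v \<Longrightarrow> c u \<noteq> c v"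
    unfolding colorable_def by metis
  have lists: "card ?A + card (c ` {v\<in>?V. 0 < excess k ?V ?A L v}) \<le> card (L a)" if "a \<in> ?A" for a
  proof -
    have "c ` {v\<in>?V. 0 < excess k ?V ?A L v} \<subseteq> {1..chromatic_number G}" using c(1) by auto
    then have "card (c ` {v\<in>?V. 0 < excess k ?V ?A L v}) \<le> chromatic_number G"
      using card_mono[of "{1..chromatic_number G}"] by fastforce
    then show ?thesis using assms(7) that by fastforce
  qed
  have "max (real (degree G v) - real (card (L v)) + real (card ?A) + real k) 0 = real (excess k ?V ?A L v)"
    if "v \<in> ?V" for v
    unfolding excess_def deg_def degree_eq_card_neighbours[OF assms(2) that] by linarith
  then have "(2 * real k + 2) / (2 * real k + 1) * real (\<Sum>v\<in>?V. excess k ?V ?A L v) \<le> real (card ?A)"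
    using assms(8) by simp
  then have "(2 * real k + 2) * real (\<Sum>v\<in>?V. excess k ?V ?A L v) \<le> (2 * real k + 1) * real (card ?A)"
    by (simp add: field_simps)
  then have "real ((2 * k + 2) * (\<Sum>v\<in>?V. excess k ?V ?A L v)) \<le> real ((2 * k + 1) * card ?A)"
    by (simp add: algebra_simps)
  then have "(2 * k + 2) * (\<Sum>v\<in>?V. excess k ?V ?A L v) \<le> (2 * k + 1) * card ?A"
    by (simp only: of_nat_le_iff)
  then have "feasible k c ?V ?A L" using covers lists unfolding feasible_def by auto
  then have "\<exists>f. colours (?V \<union> ?A) L f" using assms(1)
    by (rule feasible_colours) (rule c(2))
  then obtain f where f: "colours (?V \<union> ?A) L f" by blast
  have fL: "f u \<in> L u" if "u \<in> ?V \<union> ?A" for u using f that unfolding colours_def by auto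
  have "inj_on f (?V \<union> ?A)"
  proof (rule inj_onI, rule ccontr)
    fix u v assume "u \<in> ?V \<union> ?A" "v \<in> ?V \<union> ?A" "f u = f v" "u \<noteq> v"
    then show False using fL[of u] fL[of v] disj unfolding disjoint_family_on_def by auto
  qed
  then have "card (f ` (?V \<union> ?A)) = card (verts (join G A))" unfolding vJ by (rule card_image)
  moreover have "independent_set H (f ` (?V \<union> ?A))"
    unfolding independent_set_def
  proof (intro conjI ballI)
    show "f ` (?V \<union> ?A) \<subseteq> verts H" using fL LH by auto
    fix x y assume "x \<in> f ` (?V \<union> ?A)" "y \<in> f ` (?V \<union> ?A)"
    then obtain u v where "u \<in> ?V \<union> ?A" "v \<in> ?V \<union> ?A" "x = f u" "y = f v" by blast
    then show "\<not> adjacent H x y"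
      using f not_adjacent_self[OF sH] unfolding colours_def by (cases "u = v") auto
  qed
  ultimately show ?thesis unfolding cover_colorable_def cover_coloring_def by auto
qed

end
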